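(* Let $n\ge1$, $T\ge1$, $\lambda>0$, and consider either of the following two cases. (1) Let $Q\in\mathbb{S}^{n+1}$ be the matrix defined in the context, let $h=k+1$ (if the sparsity level $k\in\{0,\dots,n\}$ of the true solution is known) or $h=n+1$ (otherwise), let $f(X)=\langle Q,X\rangle+\lambda h\,\mathrm{tr}(X)$, and let $\mathcal{C}=\{X\in\mathbb{S}_+^{n+1}: X_{0,0}=1,\ X_{i,i}=X_{0,i},\ i=1,\dots,n\}$. Let $X_0$ be a minimizer of $\langle Q,X\rangle$ over $X\in\mathcal{C}$, and for $t=1,\dots,T$ let $$X_t\in\operatorname{argmin}_{X\in\mathcal{C}}\ \langle Q,X\rangle+\lambda\left[h\,\mathrm{tr}(X)-\langle X_{t-1},X\rangle\right].$$ (2) Let $R\in\mathbb{S}^{n+1}$, let $f(X)=\langle R,X\rangle$, and let $\mathcal{C}=\{X\in\mathbb{S}_+^{n+1}: X_{i,i}=1,\ i=0,\dots,n\}$. Let $X_0$ be a minimizer of $\langle R,X\rangle$ over $X\in\mathcal{C}$, and for $t=1,\dots,T$ let $$X_t\in\operatorname{argmin}_{X\in\mathcal{C}}\ \langle R,X\rangle-\lambda\langle X_{t-1},X\rangle .$$ In each case define $F(X)=f(X)-\frac{\lambda}{2}\langle X,X\rangle$. Then $F(X_t)$ is non-increasing in $t$, i.e. $F(X_t)\le F(X_{t-1})$ for all $t=1,\dots,T$.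
   Context: $\mathbb{S}^{N}$ is the space of real symmetric $N\times N$ matrices and $\mathbb{S}_+^{N}\subset\mathbb{S}^{N}$ the subset of positive semidefinite ones; rows and columns of $(n+1)\times(n+1)$ matrices are indexed by $0,\dots,n$. $\langle A,B\rangle=\mathrm{tr}(A^TB)$ is the Frobenius inner product. Here $X_t$ (single index) denotes the $t$-th iterate, a matrix, while $X_{i,j}$ denotes a matrix entry. The matrix $Q$ is $$Q=\begin{pmatrix}0&d^T\\ d&C\end{pmatrix}+\mu\,(-b\,|\,A)^T(-b\,|\,A),$$ where $C\in\mathbb{S}^n$, $d\in\mathbb{R}^n$, $A\in\mathbb{R}^{m\times n}$, $b\in\mathbb{R}^m$, $\mu>0$, and $(-b\,|\,A)$ is the $m\times(n+1)$ matrix with first column $-b$ followed by the columns of $A$. The true solution is the minimizer of $x^TQx$ over $x\in\{0,1\}^{n+1}$ with $x_0=1$, and its sparsity level $k$ is the number of its nonzero entries among $x_1,\dots,x_n$. *)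

theory Defs
  imports Complex_Main "Jordan_Normal_Form.Matrix"
begin

definition sym_mats :: "nat \<Rightarrow> real mat set" where
  "sym_mats N = {X \<in> carrier_mat N N. transpose_mat X = X}"

definition psd_mats :: "nat \<Rightarrow> real mat set" where
  "psd_mats N = {X \<in> sym_mats N. \<forall>v \<in> carrier_vec N. 0 \<le> v \<bullet> (X *\<^sub>v v)}"

definition tr :: "real mat \<Rightarrow> real" where
  "tr X = (\<Sum>i<dim_row X. X $$ (i, i))"

definition frob_inner :: "real mat \<Rightarrow> real mat \<Rightarrow> real" where
  "frob_inner X Y = tr (transpose_mat X * Y)"

definition prepend_col :: "real vec \<Rightarrow> real mat \<Rightarrow> real mat" where
  "prepend_col v A = mat_of_cols (dim_row A) (v # cols A)"

definition penalty_matrix ::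
    "real mat \<Rightarrow> real vec \<Rightarrow> real \<Rightarrow> real mat \<Rightarrow> real vec \<Rightarrow> real mat" where
  "penalty_matrix C d \<mu> A b =
     four_block_mat (0\<^sub>m 1 1) (mat_of_row d) (transpose_mat (mat_of_row d)) C
     + \<mu> \<cdot>\<^sub>m (transpose_mat (prepend_col (- b) A) * prepend_col (- b) A)"

definition binary_vecs :: "nat \<Rightarrow> real vec set" where
  "binary_vecs n = {x \<in> carrier_vec (n + 1). (\<forall>i<n + 1. x $ i \<in> {0, 1}) \<and> x $ 0 = 1}"

definition is_true_solution :: "nat \<Rightarrow> real mat \<Rightarrow> real vec \<Rightarrow> bool" where
  "is_true_solution n Q = is_arg_min (\<lambda>x. x \<bullet> (Q *\<^sub>v x)) (\<lambda>x. x \<in> binary_vecs n)"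

(* The homogenizing entry x $ 0 = 1 is not counted. *)
definition sparsity :: "nat \<Rightarrow> real vec \<Rightarrow> nat" where
  "sparsity n x = card {i \<in> {1..n}. x $ i \<noteq> 0}"

definition binary_relaxation :: "nat \<Rightarrow> real mat set" where
  "binary_relaxation n =
     {X \<in> psd_mats (n + 1). X $$ (0, 0) = 1 \<and> (\<forall>i\<in>{1..n}. X $$ (i, i) = X $$ (0, i))}"

definition elliptope :: "nat \<Rightarrow> real mat set" where
  "elliptope n = {X \<in> psd_mats (n + 1). \<forall>i\<in>{0..n}. X $$ (i, i) = 1}"

end

theory Submission
  imports Defs
begin

text \<open>
  Write \<open>F = f - (\<lambda>/2) \<langle>\<cdot>, \<cdot>\<rangle>\<close>. The function \<open>X \<mapsto> (\<lambda>/2) \<langle>X, X\<rangle>\<close> is convex, so replacing it by its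
  linearization at the previous iterate \<open>P\<close> yields a majorant of \<open>F\<close> that is tight at \<open>P\<close>;
  up to a constant it is \<open>f(X) - \<lambda> \<langle>P, X\<rangle>\<close>. In both cases of the theorem this majorant is exactly
  what the iteration minimizes over the feasible set, and \<open>P\<close> itself is feasible. Hence the majorant,
  and with it \<open>F\<close>, cannot increase. The majorization is the inequality
  \<open>2 \<langle>P, X\<rangle> \<le> \<langle>P, P\<rangle> + \<langle>X, X\<rangle>\<close> of lemma \<open>frob_inner_le_half_squares\<close>, and
  \<open>linearized_descent\<close> is the resulting descent for an arbitrary \<open>f\<close> and an arbitrary set
  of matrices of a common size.
\<close>

lemma frob_inner_entries:
  assumes "X \<in> carrier_mat m n" "Y \<in> carrier_mat m n"
  shows "frob_inner X Y = (\<Sum>j<n. \<Sum>i<m. X $$ (i, j) * Y $$ (i, j))"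
  using assms by (auto simp: frob_inner_def tr_def scalar_prod_def atLeast0LessThan
      intro!: sum.cong)

text \<open>This is \<open>\<langle>X - Y, X - Y\<rangle> \<ge> 0\<close>, expanded entry by entry.\<close>

lemma frob_inner_le_half_squares:
  assumes "X \<in> carrier_mat m n" "Y \<in> carrier_mat m n"
  shows "2 * frob_inner X Y \<le> frob_inner X X + frob_inner Y Y"
proof -
  have *: "2 * (x * y) \<le> x * x + y * y" for x y :: real
    using sum_squares_bound[of x y] by (simp add: power2_eq_square)
  show ?thesis
    unfolding frob_inner_entries[OF assms] frob_inner_entries[OF assms(1) assms(1)]
      frob_inner_entries[OF assms(2) assms(2)] sum_distrib_left sum.distrib[symmetric]
    by (intro sum_mono *)
qed

text \<open>
  Minimality of \<open>X t\<close> compared against the feasible competitor \<open>X (t - 1)\<close> bounds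
  \<open>f (X t) - f (X (t - 1))\<close> by \<open>lam * \<langle>P, X t - P\<rangle>\<close> with \<open>P = X (t - 1)\<close>, and this is at most the
  growth of \<open>(lam / 2) * \<langle>X, X\<rangle>\<close> by convexity. Feasibility at time 0 is a separate hypothesis
  because \<open>X 0\<close> does not come from the iteration.
\<close>

lemma linearized_descent:
  fixes X :: "nat \<Rightarrow> real mat"
  assumes S: "S \<subseteq> carrier_mat m n" and lam: "0 \<le> lam"
    and init: "X 0 \<in> S"
    and step: "\<And>t. t \<in> {1..T} \<Longrightarrow>
      is_arg_min (\<lambda>Y. f Y - lam * frob_inner (X (t - 1)) Y) (\<lambda>Y. Y \<in> S) (X t)"
    and t: "t \<in> {1..T}"
  shows "f (X t) - lam / 2 * frob_inner (X t) (X t)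
    \<le> f (X (t - 1)) - lam / 2 * frob_inner (X (t - 1)) (X (t - 1))"
proof -
  let ?P = "X (t - 1)"
  have Xt: "X t \<in> S"
    using step[OF t] by (simp add: is_arg_min_def)
  have P: "?P \<in> S"
  proof (cases "t = 1")
    case True
    with init show ?thesis by simp
  next
    case False
    with t have "t - 1 \<in> {1..T}" by auto
    from step[OF this] show ?thesis by (simp add: is_arg_min_def)
  qed
  have "f (X t) - lam * frob_inner ?P (X t) \<le> f ?P - lam * frob_inner ?P ?P"
    using step[OF t] P by (auto simp: is_arg_min_linorder)
  moreover have "lam * (2 * frob_inner ?P (X t))
      \<le> lam * (frob_inner ?P ?P + frob_inner (X t) (X t))"
    using frob_inner_le_half_squares[of ?P m n "X t"] S P Xt lam by (intro mult_left_mono) auto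
  ultimately show ?thesis by (simp add: algebra_simps)
qed

lemma binary_relaxation_carrier: "binary_relaxation n \<subseteq> carrier_mat (n + 1) (n + 1)"
  by (auto simp: binary_relaxation_def psd_mats_def sym_mats_def)

lemma elliptope_carrier: "elliptope n \<subseteq> carrier_mat (n + 1) (n + 1)"
  by (auto simp: elliptope_def psd_mats_def sym_mats_def)

theorem proposition3:
  fixes n T :: nat and lam :: real
  assumes "n \<ge> 1" and "T \<ge> 1" and "lam > 0"
  shows
    "(\<forall>(m::nat) C d (\<mu>::real) A b Q h f F (X :: nat \<Rightarrow> real mat).
        C \<in> sym_mats n \<longrightarrow> d \<in> carrier_vec n \<longrightarrow> A \<in> carrier_mat m n \<longrightarrow> b \<in> carrier_vec m \<longrightarrow>
        \<mu> > 0 \<longrightarrow>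
        Q = penalty_matrix C d \<mu> A b \<longrightarrow>
        (\<exists>x. is_true_solution n Q x \<and> h = real (sparsity n x) + 1) \<or> h = real n + 1 \<longrightarrow>
        f = (\<lambda>Y. frob_inner Q Y + lam * h * tr Y) \<longrightarrow>
        F = (\<lambda>Y. f Y - lam / 2 * frob_inner Y Y) \<longrightarrow>
        is_arg_min (\<lambda>Y. frob_inner Q Y) (\<lambda>Y. Y \<in> binary_relaxation n) (X 0) \<longrightarrow>
        (\<forall>t\<in>{1..T}. is_arg_min
            (\<lambda>Y. frob_inner Q Y + lam * (h * tr Y - frob_inner (X (t - 1)) Y))
            (\<lambda>Y. Y \<in> binary_relaxation n) (X t)) \<longrightarrow>
        (\<forall>t\<in>{1..T}. F (X t) \<le> F (X (t - 1))))
     \<and>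
     (\<forall>R f F (X :: nat \<Rightarrow> real mat).
        R \<in> sym_mats (n + 1) \<longrightarrow>
        f = (\<lambda>Y. frob_inner R Y) \<longrightarrow>
        F = (\<lambda>Y. f Y - lam / 2 * frob_inner Y Y) \<longrightarrow>
        is_arg_min (\<lambda>Y. frob_inner R Y) (\<lambda>Y. Y \<in> elliptope n) (X 0) \<longrightarrow>
        (\<forall>t\<in>{1..T}. is_arg_min
            (\<lambda>Y. frob_inner R Y - lam * frob_inner (X (t - 1)) Y)
            (\<lambda>Y. Y \<in> elliptope n) (X t)) \<longrightarrow>
        (\<forall>t\<in>{1..T}. F (X t) \<le> F (X (t - 1))))"
proof (intro conjI allI impI ballI)
  fix m :: nat and C A Q :: "real mat" and d b :: "real vec" and \<mu> h :: real
    and f F :: "real mat \<Rightarrow> real" and X :: "nat \<Rightarrow> real mat" and t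
  assume f: "f = (\<lambda>Y. frob_inner Q Y + lam * h * tr Y)"
    and F: "F = (\<lambda>Y. f Y - lam / 2 * frob_inner Y Y)"
    and init: "is_arg_min (\<lambda>Y. frob_inner Q Y) (\<lambda>Y. Y \<in> binary_relaxation n) (X 0)"
    and step: "\<forall>t\<in>{1..T}. is_arg_min
            (\<lambda>Y. frob_inner Q Y + lam * (h * tr Y - frob_inner (X (t - 1)) Y))
            (\<lambda>Y. Y \<in> binary_relaxation n) (X t)"
    and t: "t \<in> {1..T}"
  have objective: "(\<lambda>Y. frob_inner Q Y + lam * (h * tr Y - frob_inner P Y))
      = (\<lambda>Y. f Y - lam * frob_inner P Y)" for P
    by (simp add: f algebra_simps)
  show "F (X t) \<le> F (X (t - 1))"
    unfolding F
  proof (rule linearized_descent[OF binary_relaxation_carrier, where T = T])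
    show "X 0 \<in> binary_relaxation n"
      using init by (simp add: is_arg_min_def)
  qed (use assms step t in \<open>auto simp: objective\<close>)
next
  fix R :: "real mat" and f F :: "real mat \<Rightarrow> real" and X :: "nat \<Rightarrow> real mat" and t
  assume f: "f = (\<lambda>Y. frob_inner R Y)"
    and F: "F = (\<lambda>Y. f Y - lam / 2 * frob_inner Y Y)"
    and init: "is_arg_min (\<lambda>Y. frob_inner R Y) (\<lambda>Y. Y \<in> elliptope n) (X 0)"
    and step: "\<forall>t\<in>{1..T}. is_arg_min
            (\<lambda>Y. frob_inner R Y - lam * frob_inner (X (t - 1)) Y)
            (\<lambda>Y. Y \<in> elliptope n) (X t)"
    and t: "t \<in> {1..T}"
  show "F (X t) \<le> F (X (t - 1))"
    unfolding F
  proof (rule linearized_descent[OF elliptope_carrier, where T = T])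
    show "X 0 \<in> elliptope n"
      using init by (simp add: is_arg_min_def)
  qed (use assms step t in \<open>auto simp: f\<close>)
qed

end
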